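(* Let $v$ be a positive integer and, for $1 \le i \le v$, let $(X_i,\kappa_i)$ and $(Y_i,\lambda_i)$ be (nonempty) digital images and let $f_i: X_i \to Y_i$ be a function. Then the product map $$f=\prod_{i=1}^v f_i: \Big(\prod_{i=1}^v X_i,\ NP_v(\kappa_1,\ldots,\kappa_v)\Big) \to \Big(\prod_{i=1}^v Y_i,\ NP_v(\lambda_1,\ldots,\lambda_v)\Big),\qquad f(x_1,\ldots,x_v)=(f_1(x_1),\ldots,f_v(x_v)),$$ is continuous if and only if $f_i$ is $(\kappa_i,\lambda_i)$-continuous for every $i$.
   Context: A digital image $(X,\kappa)$ is a set $X$ (of lattice points in some $\mathbb{Z}^n$) with an adjacency relation $\kappa$, i.e. a symmetric irreflexive binary relation on $X$. A subset $A$ of $X$ is $\kappa$-connected if any two points $a,b\in A$ are joined by a finite sequence $a=y_0,\dots,y_m=b$ in $A$ with consecutive terms $\kappa$-adjacent. A function $f:(X,\kappa)\to(Y,\lambda)$ is $(\kappa,\lambda)$-continuous if $f(A)$ is $\lambda$-connected for every $\kappa$-connected $A\subset X$; equivalently, if for all $\kappa$-adjacent $x,x'\in X$ the points $f(x),f(x')$ are equal or $\lambda$-adjacent. $NP_v(\kappa_1,\dots,\kappa_v)$-adjacency on $\prod_{i=1}^v X_i$: two distinct points $(x_1,\dots,x_v)$ and $(x_1',\dots,x_v')$ are adjacent iff for every $i$, $x_i$ and $x_i'$ are equal or $\kappa_i$-adjacent. *)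

theory Defs
  imports Main "HOL-Library.FuncSet"
begin

text \<open>
  A lattice point of \<open>\<int>\<^sup>n\<close> is an integer list of length \<open>n\<close>, so that images of different
  dimensions can occur as factors of one product.
\<close>

definition lattice_points :: "nat \<Rightarrow> int list set" where
  "lattice_points n = {p. length p = n}"

definition adjacency_on :: "'a set \<Rightarrow> 'a rel \<Rightarrow> bool" where
  "adjacency_on X \<kappa> \<longleftrightarrow> \<kappa> \<subseteq> X \<times> X \<and> sym \<kappa> \<and> irrefl \<kappa>"

definition digital_image :: "int list set \<Rightarrow> int list rel \<Rightarrow> bool" where
  "digital_image X \<kappa> \<longleftrightarrow> (\<exists>n. X \<subseteq> lattice_points n) \<and> adjacency_on X \<kappa>"

definition dconnected :: "'a rel \<Rightarrow> 'a set \<Rightarrow> bool" where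
  "dconnected \<kappa> A \<longleftrightarrow>
    (\<forall>a\<in>A. \<forall>b\<in>A. \<exists>m. \<exists>y :: nat \<Rightarrow> 'a. y 0 = a \<and> y m = b \<and>
      (\<forall>j\<le>m. y j \<in> A) \<and> (\<forall>j<m. (y j, y (Suc j)) \<in> \<kappa>))"

definition dcontinuous :: "'a set \<Rightarrow> 'a rel \<Rightarrow> 'b set \<Rightarrow> 'b rel \<Rightarrow> ('a \<Rightarrow> 'b) \<Rightarrow> bool" where
  "dcontinuous X \<kappa> Y \<mu> f \<longleftrightarrow>
    f \<in> X \<rightarrow> Y \<and> (\<forall>A\<subseteq>X. dconnected \<kappa> A \<longrightarrow> dconnected \<mu> (f ` A))"

text \<open>
  A point \<open>(x\<^sub>1, \<dots>, x\<^sub>v)\<close> of the product is an extensional function on \<open>{1..v}\<close>;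
  the lemmas on \<open>flatten\<close> below identify such points with lattice points of
  dimension \<open>n\<^sub>1 + \<dots> + n\<^sub>v\<close>.
\<close>

definition NP :: "nat \<Rightarrow> (nat \<Rightarrow> 'a set) \<Rightarrow> (nat \<Rightarrow> 'a rel) \<Rightarrow> (nat \<Rightarrow> 'a) rel" where
  "NP v X \<kappa> = {(x, x'). x \<in> (\<Pi>\<^sub>E i\<in>{1..v}. X i) \<and> x' \<in> (\<Pi>\<^sub>E i\<in>{1..v}. X i) \<and> x \<noteq> x' \<and>
    (\<forall>i\<in>{1..v}. x i = x' i \<or> (x i, x' i) \<in> \<kappa> i)}"

definition product_map :: "nat \<Rightarrow> (nat \<Rightarrow> 'a \<Rightarrow> 'b) \<Rightarrow> (nat \<Rightarrow> 'a) \<Rightarrow> (nat \<Rightarrow> 'b)" where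
  "product_map v f x = (\<lambda>i\<in>{1..v}. f i (x i))"

lemma adjacency_on_NP:
  assumes "\<And>i. i \<in> {1..v} \<Longrightarrow> adjacency_on (X i) (\<kappa> i)"
  shows "adjacency_on (\<Pi>\<^sub>E i\<in>{1..v}. X i) (NP v X \<kappa>)"
proof -
  have \<kappa>: "sym (\<kappa> i)" if "i \<in> {1..v}" for i
    using assms[OF that] by (simp add: adjacency_on_def)
  have "sym (NP v X \<kappa>)"
  proof (rule symI)
    fix x y assume xy: "(x, y) \<in> NP v X \<kappa>"
    have "y i = x i \<or> (y i, x i) \<in> \<kappa> i" if "i \<in> {1..v}" for i
      using xy that symD[OF \<kappa>[OF that]] unfolding NP_def by fastforce
    with xy show "(y, x) \<in> NP v X \<kappa>"
      by (auto simp: NP_def)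
  qed
  then show ?thesis
    by (auto simp: adjacency_on_def NP_def irrefl_def)
qed

definition flatten :: "nat \<Rightarrow> (nat \<Rightarrow> int list) \<Rightarrow> int list" where
  "flatten v x = concat (map x [1..<Suc v])"

lemma flatten_Suc: "flatten (Suc v) x = flatten v x @ x (Suc v)"
  by (simp add: flatten_def)

lemma length_flatten:
  assumes "\<And>i. i \<in> {1..v} \<Longrightarrow> length (x i) = n i"
  shows "length (flatten v x) = (\<Sum>i=1..v. n i)"
  using assms
proof (induction v)
  case 0
  then show ?case by (simp add: flatten_def)
next
  case (Suc v)
  then show ?case by (simp add: flatten_Suc)
qed

lemma flatten_eqD:
  assumes "flatten v x = flatten v y"
    and "\<And>i. i \<in> {1..v} \<Longrightarrow> length (x i) = length (y i)"
    and "i \<in> {1..v}"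
  shows "x i = y i"
  using assms
proof (induction v)
  case (Suc v)
  have "flatten v x = flatten v y \<and> x (Suc v) = y (Suc v)"
    using Suc.prems(1,2) by (simp add: flatten_Suc)
  with Suc show ?case
    by (cases "i = Suc v") auto
qed simp

lemma inj_on_flatten:
  assumes "\<And>i. i \<in> {1..v} \<Longrightarrow> X i \<subseteq> lattice_points (n i)"
  shows "inj_on (flatten v) (\<Pi>\<^sub>E i\<in>{1..v}. X i)"
proof (rule inj_onI)
  fix x y
  assume xy: "x \<in> (\<Pi>\<^sub>E i\<in>{1..v}. X i)" "y \<in> (\<Pi>\<^sub>E i\<in>{1..v}. X i)"
    and eq: "flatten v x = flatten v y"
  have "length (x i) = length (y i)" if "i \<in> {1..v}" for i
  proof -
    have "x i \<in> lattice_points (n i)" "y i \<in> lattice_points (n i)"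
      using assms[OF that] xy that by (meson PiE_mem subsetD)+
    then show ?thesis
      by (simp add: lattice_points_def)
  qed
  with xy eq show "x = y"
    by (intro PiE_ext[OF xy] flatten_eqD[OF eq])
qed

lemma digital_image_flatten:
  assumes X: "\<And>i. i \<in> {1..v} \<Longrightarrow> X i \<subseteq> lattice_points (n i)"
    and \<kappa>: "\<And>i. i \<in> {1..v} \<Longrightarrow> adjacency_on (X i) (\<kappa> i)"
  shows "digital_image (flatten v ` (\<Pi>\<^sub>E i\<in>{1..v}. X i)) (map_prod (flatten v) (flatten v) ` NP v X \<kappa>)"
proof -
  let ?P = "\<Pi>\<^sub>E i\<in>{1..v}. X i"
  have adj: "NP v X \<kappa> \<subseteq> ?P \<times> ?P" "sym (NP v X \<kappa>)" "irrefl (NP v X \<kappa>)"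
    using adjacency_on_NP[OF \<kappa>] by (simp_all add: adjacency_on_def)
  have inj: "inj_on (flatten v) ?P"
    by (rule inj_on_flatten[OF X])
  have len: "flatten v ` ?P \<subseteq> lattice_points (\<Sum>i=1..v. n i)"
  proof (rule image_subsetI)
    fix x assume x: "x \<in> ?P"
    have "length (x i) = n i" if "i \<in> {1..v}" for i
      using PiE_mem[OF x that] X[OF that] by (auto simp: lattice_points_def)
    then show "flatten v x \<in> lattice_points (\<Sum>i=1..v. n i)"
      by (simp add: lattice_points_def length_flatten)
  qed
  have "sym (map_prod (flatten v) (flatten v) ` NP v X \<kappa>)"
    using adj(2) by (auto intro!: symI dest: symD)
  moreover have "irrefl (map_prod (flatten v) (flatten v) ` NP v X \<kappa>)"
  proof (rule irreflI)
    fix p show "(p, p) \<notin> map_prod (flatten v) (flatten v) ` NP v X \<kappa>"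
    proof
      assume "(p, p) \<in> map_prod (flatten v) (flatten v) ` NP v X \<kappa>"
      then obtain x y where xy: "(x, y) \<in> NP v X \<kappa>" "flatten v x = flatten v y"
        by auto
      then have "x = y"
        using adj(1) inj by (auto dest: inj_onD)
      with xy(1) adj(3) show False
        by (simp add: irrefl_def)
    qed
  qed
  moreover have "map_prod (flatten v) (flatten v) ` NP v X \<kappa> \<subseteq> flatten v ` ?P \<times> flatten v ` ?P"
    using adj(1) by auto
  ultimately show ?thesis
    using len by (auto simp: digital_image_def adjacency_on_def)
qed

end

theory Submission
  imports Defs
begin

text \<open>
  Both continuity statements reduce to preservation of adjacency up to equality, tested on
  connected pairs. For products this condition is checked coordinatewise; since the \<open>X i\<close> are
  nonempty, an adjacent pair of \<open>X i\<close> extends to an adjacent pair of the product that agrees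
  off the coordinate \<open>i\<close>.
\<close>

text \<open>Paths inside \<open>A\<close> are walks of the relation cut down to \<open>A\<close>, so
  connectedness becomes reachability and rtrancl induction replaces path indices.\<close>

lemma dconnected_iff_rtrancl:
  "dconnected \<kappa> A \<longleftrightarrow> (\<forall>a\<in>A. \<forall>b\<in>A. (a, b) \<in> (\<kappa> \<inter> A \<times> A)\<^sup>*)"
proof -
  have "(\<exists>m y. y 0 = a \<and> y m = b \<and> (\<forall>j\<le>m. y j \<in> A) \<and> (\<forall>j<m. (y j, y (Suc j)) \<in> \<kappa>))
      \<longleftrightarrow> (a, b) \<in> (\<kappa> \<inter> A \<times> A)\<^sup>*" (is "?L \<longleftrightarrow> ?R") if "a \<in> A" for a b
  proof
    assume ?L
    then obtain m and y :: "nat \<Rightarrow> 'a" where "y 0 = a" "y m = b"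
      "\<forall>j\<le>m. y j \<in> A" "\<forall>j<m. (y j, y (Suc j)) \<in> \<kappa>"
      by blast
    then have "(a, b) \<in> (\<kappa> \<inter> A \<times> A) ^^ m"
      unfolding relpow_fun_conv by (intro exI[of _ y]) (auto simp: Suc_le_eq)
    then show ?R
      by (rule relpow_imp_rtrancl)
  next
    assume ?R
    then obtain m and y :: "nat \<Rightarrow> 'a" where y: "y 0 = a" "y m = b"
      "\<And>j. j < m \<Longrightarrow> (y j, y (Suc j)) \<in> \<kappa> \<inter> A \<times> A"
      by (auto simp: rtrancl_is_UN_relpow relpow_fun_conv)
    \<comment> \<open>The start \<open>y 0\<close> is \<open>a\<close>, which lies in
      \<open>A\<close> by assumption; every later point is the target of a step inside
      \<open>A\<close>. This also covers paths of length 0.\<close>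
    have "y j \<in> A" if "j \<le> m" for j
      using that y \<open>a \<in> A\<close> by (cases j) auto
    with y show ?L
      by blast
  qed
  then show ?thesis
    unfolding dconnected_def by blast
qed

text \<open>Symmetry supplies the path back from \<open>b\<close> to \<open>a\<close>.\<close>

lemma dconnected_pair:
  assumes "sym \<kappa>" "(a, b) \<in> \<kappa>"
  shows "dconnected \<kappa> {a, b}"
  using assms by (auto simp: dconnected_iff_rtrancl dest: symD)

text \<open>A walk from \<open>a\<close> within the pair can only reach \<open>b\<close> by staying
  put, when \<open>a = b\<close>, or by a step from \<open>a\<close> to \<open>b\<close>.\<close>

lemma dconnected_pairD:
  assumes "dconnected \<kappa> {a, b}"
  shows "a = b \<or> (a, b) \<in> \<kappa>"
proof -
  have "(a, b) \<in> (\<kappa> \<inter> {a, b} \<times> {a, b})\<^sup>*"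
    using assms by (simp add: dconnected_iff_rtrancl)
  then show ?thesis
    by (induction rule: rtrancl_induct) auto
qed

lemma dcontinuous_iff_adjacent:
  assumes "adjacency_on X \<kappa>" "f \<in> X \<rightarrow> Y"
  shows "dcontinuous X \<kappa> Y \<mu> f \<longleftrightarrow> (\<forall>(x, x')\<in>\<kappa>. f x = f x' \<or> (f x, f x') \<in> \<mu>)"
proof (intro iffI ballI, clarify)
  fix x x' assume f: "dcontinuous X \<kappa> Y \<mu> f" and x: "(x, x') \<in> \<kappa>" and "(f x, f x') \<notin> \<mu>"
  have "dconnected \<kappa> {x, x'}" "{x, x'} \<subseteq> X"
    using assms(1) x by (auto simp: adjacency_on_def intro: dconnected_pair)
  then have "dconnected \<mu> (f ` {x, x'})"
    using f unfolding dcontinuous_def by blast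
  then show "f x = f x'"
    using dconnected_pairD[of \<mu> "f x" "f x'"] \<open>(f x, f x') \<notin> \<mu>\<close> by simp
next
  assume step: "\<forall>(x, x')\<in>\<kappa>. f x = f x' \<or> (f x, f x') \<in> \<mu>"
  have "dconnected \<mu> (f ` A)" if A: "dconnected \<kappa> A" for A
  proof -
    have "(f a, f b) \<in> (\<mu> \<inter> f ` A \<times> f ` A)\<^sup>*" if "(a, b) \<in> (\<kappa> \<inter> A \<times> A)\<^sup>*" for a b
      using that
    proof (induction rule: rtrancl_induct)
      case (step b c)
      then have "f b = f c \<or> (f b, f c) \<in> \<mu> \<inter> f ` A \<times> f ` A"
        using \<open>\<forall>(x, x')\<in>\<kappa>. f x = f x' \<or> (f x, f x') \<in> \<mu>\<close> by auto
      with step.IH show ?case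
        by (auto intro: rtrancl_into_rtrancl)
    qed simp
    with A show ?thesis
      by (auto simp: dconnected_iff_rtrancl)
  qed
  with assms(2) show "dcontinuous X \<kappa> Y \<mu> f"
    by (simp add: dcontinuous_def)
qed

lemma product_map_funcset:
  assumes "\<And>i. i \<in> {1..v} \<Longrightarrow> f i \<in> X i \<rightarrow> Y i"
  shows "product_map v f \<in> (\<Pi>\<^sub>E i\<in>{1..v}. X i) \<rightarrow> (\<Pi>\<^sub>E i\<in>{1..v}. Y i)"
  using assms by (fastforce simp: product_map_def)

theorem theorem4p1:
  fixes v :: nat
    and X Y :: "nat \<Rightarrow> int list set"
    and \<kappa> \<mu> :: "nat \<Rightarrow> int list rel"
    and f :: "nat \<Rightarrow> int list \<Rightarrow> int list"
  assumes "v \<ge> 1"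
    and "\<And>i. i \<in> {1..v} \<Longrightarrow> digital_image (X i) (\<kappa> i)"
    and "\<And>i. i \<in> {1..v} \<Longrightarrow> X i \<noteq> {}"
    and "\<And>i. i \<in> {1..v} \<Longrightarrow> digital_image (Y i) (\<mu> i)"
    and "\<And>i. i \<in> {1..v} \<Longrightarrow> Y i \<noteq> {}"
    and "\<And>i. i \<in> {1..v} \<Longrightarrow> f i \<in> X i \<rightarrow> Y i"
  shows "dcontinuous (\<Pi>\<^sub>E i\<in>{1..v}. X i) (NP v X \<kappa>) (\<Pi>\<^sub>E i\<in>{1..v}. Y i) (NP v Y \<mu>) (product_map v f)
    \<longleftrightarrow> (\<forall>i\<in>{1..v}. dcontinuous (X i) (\<kappa> i) (Y i) (\<mu> i) (f i))"
proof -
  let ?X = "\<Pi>\<^sub>E i\<in>{1..v}. X i" and ?F = "product_map v f"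
  have adj: "adjacency_on (X i) (\<kappa> i)" if "i \<in> {1..v}" for i
    using assms(2)[OF that] by (simp add: digital_image_def)
  have F: "?F \<in> ?X \<rightarrow> (\<Pi>\<^sub>E i\<in>{1..v}. Y i)"
    using assms(6) by (rule product_map_funcset)
  have "(\<forall>(x, x')\<in>NP v X \<kappa>. ?F x = ?F x' \<or> (?F x, ?F x') \<in> NP v Y \<mu>)
    \<longleftrightarrow> (\<forall>i\<in>{1..v}. \<forall>(a, a')\<in>\<kappa> i. f i a = f i a' \<or> (f i a, f i a') \<in> \<mu> i)" (is "?L \<longleftrightarrow> ?R")
  proof
    assume L: ?L
    \<comment> \<open>The base point \<open>p\<close> fills the coordinates other than
      \<open>i\<close>.\<close>
    obtain p where p: "p \<in> ?X"
      using assms(3) by (metis PiE_eq_empty_iff ex_in_conv)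
    show ?R
    proof (intro ballI, clarify)
      fix i a a'
      assume i: "i \<in> {1..v}" and a: "(a, a') \<in> \<kappa> i" and "(f i a, f i a') \<notin> \<mu> i"
      \<comment> \<open>Irreflexivity of \<open>\<kappa> i\<close> separates \<open>a\<close> from
        \<open>a'\<close>; \<open>NP\<close> relates only distinct points, so the two updates of
        \<open>p\<close> must differ.\<close>
      have X: "a \<in> X i" "a' \<in> X i" "a \<noteq> a'"
        using adj[OF i] a by (auto simp: adjacency_on_def irrefl_def)
      have upd: "p(i := c) \<in> ?X" if "c \<in> X i" for c
        using p i that by (auto simp: PiE_iff extensional_def)
      have "p(i := a) \<noteq> p(i := a')"
        using X(3) by (metis fun_upd_same)
      then have "(p(i := a), p(i := a')) \<in> NP v X \<kappa>"
        using upd X a by (simp add: NP_def)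
      with L have "?F (p(i := a)) = ?F (p(i := a')) \<or> (?F (p(i := a)), ?F (p(i := a'))) \<in> NP v Y \<mu>"
        by blast
      \<comment> \<open>Equality and \<open>NP\<close>-adjacency of the images both restrict to
        coordinate \<open>i\<close>.\<close>
      then have "?F (p(i := a)) i = ?F (p(i := a')) i \<or> (?F (p(i := a)) i, ?F (p(i := a')) i) \<in> \<mu> i"
        using i unfolding NP_def by auto
      then show "f i a = f i a'"
        using i \<open>(f i a, f i a') \<notin> \<mu> i\<close> by (simp add: product_map_def)
    qed
  next
    assume R: ?R
    show ?L
    proof clarify
      fix x x' assume x: "(x, x') \<in> NP v X \<kappa>" and nadj: "(?F x, ?F x') \<notin> NP v Y \<mu>"
      have "f i (x i) = f i (x' i) \<or> (f i (x i), f i (x' i)) \<in> \<mu> i" if "i \<in> {1..v}" for i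
      proof -
        have "x i = x' i \<or> (x i, x' i) \<in> \<kappa> i"
          using x that by (simp add: NP_def)
        with R that show ?thesis
          by fastforce
      qed
      then have "\<forall>i\<in>{1..v}. ?F x i = ?F x' i \<or> (?F x i, ?F x' i) \<in> \<mu> i"
        by (simp add: product_map_def)
      moreover have "?F x \<in> (\<Pi>\<^sub>E i\<in>{1..v}. Y i)" "?F x' \<in> (\<Pi>\<^sub>E i\<in>{1..v}. Y i)"
        using F x by (auto simp: NP_def)
      \<comment> \<open>The images satisfy every clause of \<open>NP\<close> except perhaps
        distinctness, so non-adjacency forces them to coincide.\<close>
      ultimately show "?F x = ?F x'"
        using nadj unfolding NP_def by blast
    qed
  qed
  then show ?thesis
    using dcontinuous_iff_adjacent[OF adjacency_on_NP[OF adj] F]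
      dcontinuous_iff_adjacent[OF adj assms(6)] by simp
qed

end
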